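(* Let $k$ be a positive integer. For every integer $n\geq 4$, $$\Phi_k(P_n)=\binom k2 k^{n-2}+k\,\Phi_k(P_{n-2}),$$ while $\Phi_k(P_2)=\binom k2$ and $\Phi_k(P_3)=k\binom k2$.
   Context: $P_n$ is the path on $n$ vertices. A vertex coloring of a graph $G$ (not necessarily proper) is distinguishing if the only automorphism of $G$ preserving the color of every vertex is the identity. Two colorings $c_1,c_2$ of $G$ are equivalent if there is an automorphism $\alpha$ of $G$ with $c_1(v)=c_2(\alpha(v))$ for all $v\in V(G)$. $\Phi_k(G)$ is the number of non-equivalent distinguishing colorings (equivalence classes) of $G$ with $\{1,\dots,k\}$ as the set of admissible colors (not all colors need be used). *)

theory Defs
  imports
    "Graph_Theory.Pair_Digraph"
    "HOL-Combinatorics.Permutations"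
    "HOL-Library.FuncSet"
begin

text \<open>
  Finite simple graphs are the symmetric, loop-free digraphs of locale \<^locale>\<open>pair_graph\<close>:
  an edge \<open>uv\<close> is represented by the two arcs \<open>(u, v)\<close> and \<open>(v, u)\<close>.
\<close>

definition path_graph :: "nat \<Rightarrow> nat pair_pre_digraph" where
  "path_graph n = \<lparr>pverts = {1..n},
     parcs = {(i, j). i \<in> {1..n} \<and> j \<in> {1..n} \<and> (j = Suc i \<or> i = Suc j)}\<rparr>"

lemma pair_graph_path_graph: "pair_graph (path_graph n)"
proof
  show "finite (parcs (path_graph n))"
    by (rule finite_subset[of _ "{1..n} \<times> {1..n}"]) (auto simp: path_graph_def)
  show "symmetric (with_proj (path_graph n))"
    by (auto simp: path_graph_def symmetric_def arcs_ends_def arc_to_ends_def sym_def)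
qed (auto simp: path_graph_def)

text \<open>
  Since \<open>\<alpha> permutes V\<close> makes \<open>\<alpha>\<close> the identity outside \<open>V\<close>, an automorphism is determined by
  its action on the vertices, and the trivial automorphism is exactly \<^const>\<open>id\<close>.
\<close>
definition automorphisms :: "'a pair_pre_digraph \<Rightarrow> ('a \<Rightarrow> 'a) set" where
  "automorphisms G = {\<alpha>. \<alpha> permutes pverts G \<and>
     (\<forall>u\<in>pverts G. \<forall>v\<in>pverts G. (\<alpha> u, \<alpha> v) \<in> parcs G \<longleftrightarrow> (u, v) \<in> parcs G)}"

definition distinguishing :: "'a pair_pre_digraph \<Rightarrow> ('a \<Rightarrow> 'c) \<Rightarrow> bool" where
  "distinguishing G c \<longleftrightarrow>
     (\<forall>\<alpha>\<in>automorphisms G. (\<forall>v\<in>pverts G. c (\<alpha> v) = c v) \<longrightarrow> \<alpha> = id)"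

definition equivalent_colorings :: "'a pair_pre_digraph \<Rightarrow> ('a \<Rightarrow> 'c) \<Rightarrow> ('a \<Rightarrow> 'c) \<Rightarrow> bool" where
  "equivalent_colorings G c1 c2 \<longleftrightarrow>
     (\<exists>\<alpha>\<in>automorphisms G. \<forall>v\<in>pverts G. c1 v = c2 (\<alpha> v))"

text \<open>
  Colorings are taken extensionally, so that each coloring of the vertex set is counted once.
\<close>
definition distinguishing_colorings :: "nat \<Rightarrow> 'a pair_pre_digraph \<Rightarrow> ('a \<Rightarrow> nat) set" where
  "distinguishing_colorings k G = {c \<in> pverts G \<rightarrow>\<^sub>E {1..k}. distinguishing G c}"

definition coloring_rel :: "nat \<Rightarrow> 'a pair_pre_digraph \<Rightarrow> (('a \<Rightarrow> nat) \<times> ('a \<Rightarrow> nat)) set" where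
  "coloring_rel k G = {(c1, c2). c1 \<in> distinguishing_colorings k G \<and>
     c2 \<in> distinguishing_colorings k G \<and> equivalent_colorings G c1 c2}"

definition Phi :: "nat \<Rightarrow> 'a pair_pre_digraph \<Rightarrow> nat" where
  "Phi k G = card (distinguishing_colorings k G // coloring_rel k G)"

lemma id_in_automorphisms: "id \<in> automorphisms G"
  by (simp add: automorphisms_def permutes_id)

lemma comp_in_automorphisms:
  assumes "\<alpha> \<in> automorphisms G" "\<beta> \<in> automorphisms G"
  shows "\<beta> \<circ> \<alpha> \<in> automorphisms G"
  using assms by (auto simp: automorphisms_def permutes_compose permutes_in_image)

lemma inv_in_automorphisms:
  assumes "\<alpha> \<in> automorphisms G"
  shows "inv \<alpha> \<in> automorphisms G"
proof -
  have p: "\<alpha> permutes pverts G"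
    and e: "\<And>u v. u \<in> pverts G \<Longrightarrow> v \<in> pverts G \<Longrightarrow>
      (\<alpha> u, \<alpha> v) \<in> parcs G \<longleftrightarrow> (u, v) \<in> parcs G"
    using assms by (auto simp: automorphisms_def)
  have q: "inv \<alpha> permutes pverts G" using p by (rule permutes_inv)
  have "(inv \<alpha> u, inv \<alpha> v) \<in> parcs G \<longleftrightarrow> (u, v) \<in> parcs G"
    if "u \<in> pverts G" "v \<in> pverts G" for u v
    using e[of "inv \<alpha> u" "inv \<alpha> v"] that
    by (simp add: permutes_in_image[OF q] permutes_inverses(1)[OF p])
  with q show ?thesis by (simp add: automorphisms_def)
qed

lemma equiv_coloring_rel: "equiv (distinguishing_colorings k G) (coloring_rel k G)"
proof (rule equivI)
  show "coloring_rel k G \<subseteq> distinguishing_colorings k G \<times> distinguishing_colorings k G"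
    by (auto simp: coloring_rel_def)
  show "refl_on (distinguishing_colorings k G) (coloring_rel k G)"
    by (auto simp: refl_on_def coloring_rel_def equivalent_colorings_def
        intro!: bexI[OF _ id_in_automorphisms])
  show "sym (coloring_rel k G)"
  proof (rule symI)
    fix c1 c2 assume a: "(c1, c2) \<in> coloring_rel k G"
    then obtain \<alpha> where \<alpha>: "\<alpha> \<in> automorphisms G" "\<forall>v\<in>pverts G. c1 v = c2 (\<alpha> v)"
      by (auto simp: coloring_rel_def equivalent_colorings_def)
    then have p: "\<alpha> permutes pverts G" by (simp add: automorphisms_def)
    have "c2 v = c1 (inv \<alpha> v)" if "v \<in> pverts G" for v
      using \<alpha>(2) that
      by (simp add: permutes_in_image[OF permutes_inv[OF p]] permutes_inverses(1)[OF p])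
    with a inv_in_automorphisms[OF \<alpha>(1)] show "(c2, c1) \<in> coloring_rel k G"
      by (auto simp: coloring_rel_def equivalent_colorings_def)
  qed
  show "trans (coloring_rel k G)"
  proof (rule transI)
    fix c1 c2 c3
    assume a: "(c1, c2) \<in> coloring_rel k G" and b: "(c2, c3) \<in> coloring_rel k G"
    obtain \<alpha> where \<alpha>: "\<alpha> \<in> automorphisms G" "\<forall>v\<in>pverts G. c1 v = c2 (\<alpha> v)"
      using a by (auto simp: coloring_rel_def equivalent_colorings_def)
    obtain \<beta> where \<beta>: "\<beta> \<in> automorphisms G" "\<forall>v\<in>pverts G. c2 v = c3 (\<beta> v)"
      using b by (auto simp: coloring_rel_def equivalent_colorings_def)
    have "\<forall>v\<in>pverts G. c1 v = c3 ((\<beta> \<circ> \<alpha>) v)"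
      using \<alpha> \<beta> by (simp add: automorphisms_def permutes_in_image)
    with comp_in_automorphisms[OF \<alpha>(1) \<beta>(1)] have "equivalent_colorings G c1 c3"
      unfolding equivalent_colorings_def by blast
    with a b show "(c1, c3) \<in> coloring_rel k G"
      by (simp add: coloring_rel_def)
  qed
qed

text \<open>
  The set of classes is finite whenever \<open>G\<close> is, so \<^const>\<open>card\<close> in \<^const>\<open>Phi\<close> is the true number
  of classes.
\<close>
lemma finite_distinguishing_classes:
  assumes "finite (pverts G)"
  shows "finite (distinguishing_colorings k G // coloring_rel k G)"
proof (rule finite_quotient)
  show "finite (distinguishing_colorings k G)"
    using assms by (simp add: distinguishing_colorings_def finite_PiE)
  show "coloring_rel k G \<subseteq> distinguishing_colorings k G \<times> distinguishing_colorings k G"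
    by (auto simp: coloring_rel_def)
qed

end

theory Submission
  imports Defs
begin

text \<open>
  The automorphism group of any finite graph acts on its distinguishing colorings by
  precomposition, and this action is free: a distinguishing coloring has, by definition, trivial
  stabilizer.  Hence every equivalence class has as many members as there are automorphisms, so
  counting classes reduces to counting colorings (\<open>card_distinguishing_colorings\<close>).

  For \<open>n \<ge> 2\<close> the path has exactly two automorphisms, the identity and the reversal
  \<open>i \<mapsto> n + 1 - i\<close> (\<open>automorphisms_path_graph\<close>).  A coloring therefore fails to distinguish exactly
  if it is a palindrome, and a palindrome is given freely by its first \<open>\<lceil>n/2\<rceil>\<close> entries.  This
  yields the closed form \<open>2 \<Phi>\<^sub>k(P\<^sub>n) + k\<^bsup>\<lceil>n/2\<rceil>\<^esup> = k\<^sup>n\<close> (\<open>Phi_path_graph\<close>).  The recurrence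
  and both initial values are arithmetic consequences of it, since passing from \<open>n - 2\<close> to \<open>n\<close>
  multiplies the number of palindromes by \<open>k\<close> and \<open>k\<^sup>n - k\<^bsup>n-1\<^esup> = 2 (k choose 2) k\<^bsup>n-2\<^esup>\<close>.
\<close>

section \<open>Counting classes by the free action of the automorphism group\<close>

lemma automorphisms_permutes: "\<alpha> \<in> automorphisms G \<Longrightarrow> \<alpha> permutes pverts G"
  by (simp add: automorphisms_def)

text \<open>
  The restriction keeps \<open>c \<circ> \<alpha>\<close> extensional, so that it is again one of the counted colorings.
\<close>
definition recolor :: "'a pair_pre_digraph \<Rightarrow> ('a \<Rightarrow> 'c) \<Rightarrow> ('a \<Rightarrow> 'a) \<Rightarrow> 'a \<Rightarrow> 'c" where
  "recolor G c \<alpha> = restrict (c \<circ> \<alpha>) (pverts G)"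

text \<open>
  The stabilizer of \<open>c \<circ> \<alpha>\<close> is conjugate by \<open>\<alpha>\<close> to that of \<open>c\<close>, so it is trivial as well.
\<close>
lemma recolor_in_distinguishing_colorings:
  assumes c: "c \<in> distinguishing_colorings k G" and \<alpha>: "\<alpha> \<in> automorphisms G"
  shows "recolor G c \<alpha> \<in> distinguishing_colorings k G"
proof -
  note p = automorphisms_permutes[OF \<alpha>]
  have "\<beta> = id"
    if \<beta>: "\<beta> \<in> automorphisms G"
      and inv_c: "\<And>v. v \<in> pverts G \<Longrightarrow> recolor G c \<alpha> (\<beta> v) = recolor G c \<alpha> v" for \<beta>
  proof -
    note q = automorphisms_permutes[OF \<beta>]
    let ?\<gamma> = "\<alpha> \<circ> (\<beta> \<circ> inv \<alpha>)"
    have \<gamma>: "?\<gamma> \<in> automorphisms G"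
      by (intro comp_in_automorphisms inv_in_automorphisms \<alpha> \<beta>)
    have "c (?\<gamma> v) = c v" if "v \<in> pverts G" for v
    proof -
      have "inv \<alpha> v \<in> pverts G" "\<beta> (inv \<alpha> v) \<in> pverts G"
        using that p q by (simp_all add: permutes_inv permutes_in_image)
      with inv_c[of "inv \<alpha> v"] show ?thesis
        by (simp add: recolor_def permutes_inverses(1)[OF p])
    qed
    with \<gamma> c have \<gamma>id: "?\<gamma> = id"
      unfolding distinguishing_colorings_def distinguishing_def by blast
    have "\<alpha> (\<beta> v) = \<alpha> v" for v
      using fun_cong[OF \<gamma>id, of "\<alpha> v"] by (simp add: permutes_inverses(2)[OF p])
    then show ?thesis
      using permutes_inj[OF p] by (auto simp: inj_def)
  qed
  moreover have "recolor G c \<alpha> \<in> pverts G \<rightarrow>\<^sub>E {1..k}"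
    using c p by (auto simp: recolor_def distinguishing_colorings_def permutes_in_image)
  ultimately show ?thesis
    by (auto simp: distinguishing_colorings_def distinguishing_def)
qed

lemma inj_on_recolor:
  assumes c: "c \<in> distinguishing_colorings k G"
  shows "inj_on (recolor G c) (automorphisms G)"
proof (rule inj_onI)
  fix \<alpha> \<beta>
  assume \<alpha>: "\<alpha> \<in> automorphisms G" and \<beta>: "\<beta> \<in> automorphisms G"
    and eq: "recolor G c \<alpha> = recolor G c \<beta>"
  note p = automorphisms_permutes[OF \<alpha>] and q = automorphisms_permutes[OF \<beta>]
  have "c ((\<alpha> \<circ> inv \<beta>) v) = c v" if "v \<in> pverts G" for v
  proof -
    have "inv \<beta> v \<in> pverts G"
      using that q by (simp add: permutes_inv permutes_in_image)
    with fun_cong[OF eq, of "inv \<beta> v"] show ?thesis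
      by (simp add: recolor_def permutes_inverses(1)[OF q])
  qed
  moreover have "\<alpha> \<circ> inv \<beta> \<in> automorphisms G"
    by (intro comp_in_automorphisms inv_in_automorphisms \<alpha> \<beta>)
  ultimately have id: "\<alpha> \<circ> inv \<beta> = id"
    using c unfolding distinguishing_colorings_def distinguishing_def by blast
  show "\<alpha> = \<beta>"
  proof
    fix v
    show "\<alpha> v = \<beta> v"
      using fun_cong[OF id, of "\<beta> v"] by (simp add: permutes_inverses(2)[OF q])
  qed
qed

lemma coloring_class_eq_orbit:
  assumes c: "c \<in> distinguishing_colorings k G"
  shows "coloring_rel k G `` {c} = recolor G c ` automorphisms G"
proof (intro equalityI subsetI)
  fix d assume "d \<in> coloring_rel k G `` {c}"
  then obtain \<alpha> where d: "d \<in> distinguishing_colorings k G"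
    and \<alpha>: "\<alpha> \<in> automorphisms G" and cd: "\<And>v. v \<in> pverts G \<Longrightarrow> c v = d (\<alpha> v)"
    by (auto simp: coloring_rel_def equivalent_colorings_def)
  note p = automorphisms_permutes[OF \<alpha>]
  have "d \<in> extensional (pverts G)"
    using d by (auto simp: distinguishing_colorings_def PiE_def)
  moreover have "d v = recolor G c (inv \<alpha>) v" if "v \<in> pverts G" for v
    using that p cd[of "inv \<alpha> v"]
    by (simp add: recolor_def permutes_inv permutes_in_image permutes_inverses(1)[OF p])
  ultimately have "d = recolor G c (inv \<alpha>)"
    by (intro extensionalityI[of _ "pverts G"]) (auto simp: recolor_def)
  then show "d \<in> recolor G c ` automorphisms G"
    using inv_in_automorphisms[OF \<alpha>] by blast
next
  fix d assume "d \<in> recolor G c ` automorphisms G"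
  then obtain \<alpha> where \<alpha>: "\<alpha> \<in> automorphisms G" and d: "d = recolor G c \<alpha>" by blast
  note p = automorphisms_permutes[OF \<alpha>]
  have "c v = d (inv \<alpha> v)" if "v \<in> pverts G" for v
    using that p
    by (simp add: d recolor_def permutes_inv permutes_in_image permutes_inverses(1)[OF p])
  with inv_in_automorphisms[OF \<alpha>] have "equivalent_colorings G c d"
    unfolding equivalent_colorings_def by blast
  with c recolor_in_distinguishing_colorings[OF c \<alpha>]
  show "d \<in> coloring_rel k G `` {c}"
    by (simp add: coloring_rel_def d)
qed

text \<open>
  Every class is a free orbit, so the classes partition the distinguishing colorings into parts
  of equal size.
\<close>
lemma card_distinguishing_colorings:
  assumes "finite (pverts G)"
  shows "card (distinguishing_colorings k G) = card (automorphisms G) * Phi k G"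
proof -
  let ?D = "distinguishing_colorings k G" and ?R = "coloring_rel k G"
  have equiv: "equiv ?D ?R" by (rule equiv_coloring_rel)
  have union: "\<Union> (?D // ?R) = ?D" by (rule Union_quotient[OF equiv])
  have fin: "finite ?D"
    using assms by (simp add: distinguishing_colorings_def finite_PiE)
  have "card (automorphisms G) * card (?D // ?R) = card (\<Union> (?D // ?R))"
  proof (rule card_partition)
    show "finite (?D // ?R)" by (rule finite_distinguishing_classes[OF assms])
    show "finite (\<Union> (?D // ?R))" using union fin by simp
    show "card X = card (automorphisms G)" if "X \<in> ?D // ?R" for X
      using that by (auto elim!: quotientE simp: coloring_class_eq_orbit card_image inj_on_recolor)
    show "X \<inter> Y = {}" if "X \<in> ?D // ?R" "Y \<in> ?D // ?R" "X \<noteq> Y" for X Y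
      using quotient_disj[OF equiv that(1,2)] that(3) by blast
  qed
  then show ?thesis by (simp add: union Phi_def)
qed

section \<open>Automorphisms of a path\<close>

lemma pverts_path_graph [simp]: "pverts (path_graph n) = {1..n}"
  by (simp add: path_graph_def)

lemma parcs_path_graph:
  "(i, j) \<in> parcs (path_graph n) \<longleftrightarrow> i \<in> {1..n} \<and> j \<in> {1..n} \<and> (j = Suc i \<or> i = Suc j)"
  by (simp add: path_graph_def)

definition path_reversal :: "nat \<Rightarrow> nat \<Rightarrow> nat" where
  "path_reversal n i = (if i \<in> {1..n} then Suc n - i else i)"

lemma path_reversal_involution [simp]: "path_reversal n (path_reversal n i) = i"
  by (auto simp: path_reversal_def)

lemma path_reversal_in_automorphisms: "path_reversal n \<in> automorphisms (path_graph n)"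
proof -
  have "bij_betw (path_reversal n) {1..n} {1..n}"
    by (rule bij_betw_byWitness[where f' = "path_reversal n"])
       (simp_all add: image_subset_iff, auto simp: path_reversal_def)
  then have "path_reversal n permutes {1..n}"
    by (rule bij_imp_permutes) (auto simp: path_reversal_def)
  moreover have "(path_reversal n i, path_reversal n j) \<in> parcs (path_graph n)
      \<longleftrightarrow> (i, j) \<in> parcs (path_graph n)" if "i \<in> {1..n}" "j \<in> {1..n}" for i j
    using that by (auto simp: parcs_path_graph path_reversal_def)
  ultimately show ?thesis
    by (simp add: automorphisms_def)
qed

text \<open>
  An automorphism fixing an end of the path is forced step by step: once \<open>i - 1\<close> and \<open>i\<close> are fixed,
  injectivity leaves \<open>i + 1\<close> as the only neighbour of \<open>i\<close> to which \<open>i + 1\<close> can go.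
\<close>
lemma path_automorphism_fixing_end:
  assumes \<alpha>: "\<alpha> \<in> automorphisms (path_graph n)" and start: "\<alpha> 1 = 1"
  shows "\<alpha> = id"
proof
  have p: "\<alpha> permutes {1..n}"
    using automorphisms_permutes[OF \<alpha>] by simp
  have fixed: "\<alpha> i = i" if "i \<in> {1..n}" for i
    using that
  proof (induction i rule: less_induct)
    case (less i)
    show ?case
    proof (cases "i = 1")
      case False
      with less.prems obtain j where j: "i = Suc j" "1 \<le> j"
        by (cases i) auto
      then have \<alpha>j: "\<alpha> j = j" using less by auto
      have "(\<alpha> j, \<alpha> i) \<in> parcs (path_graph n)"
        using \<alpha> j less.prems by (auto simp: automorphisms_def parcs_path_graph)
      then have "\<alpha> i = Suc j \<or> (\<alpha> i = j - 1 \<and> j - 1 \<in> {1..n})"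
        by (auto simp: parcs_path_graph \<alpha>j)
      moreover have "\<alpha> i \<noteq> j - 1" if "j - 1 \<in> {1..n}"
      proof -
        have "\<alpha> (j - 1) = j - 1" using less.IH[of "j - 1"] j that by auto
        then show ?thesis
          using inj_eq[OF permutes_inj[OF p], of i "j - 1"] j by simp
      qed
      ultimately show ?thesis using j by blast
    qed (use start in simp)
  qed
  fix i
  show "\<alpha> i = id i"
    using fixed[of i] permutes_not_in[OF p, of i] by (cases "i \<in> {1..n}") simp_all
qed

text \<open>
  An automorphism preserves degrees, and an inner vertex has two neighbours while \<open>1\<close> has only one.
\<close>
lemma path_automorphism_end:
  assumes \<alpha>: "\<alpha> \<in> automorphisms (path_graph n)" and n: "n \<ge> 1"
  shows "\<alpha> 1 = 1 \<or> \<alpha> 1 = n"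
proof (rule ccontr)
  assume inner: "\<not> ?thesis"
  have p: "\<alpha> permutes {1..n}"
    using automorphisms_permutes[OF \<alpha>] by simp
  have a: "\<alpha> 1 \<in> {1..n}" using permutes_in_image[OF p] n by simp
  have only: "j = \<alpha> 2" if j: "(\<alpha> 1, j) \<in> parcs (path_graph n)" for j
  proof -
    have "j \<in> {1..n}" using j by (simp add: parcs_path_graph)
    then obtain i where i: "i \<in> {1..n}" "j = \<alpha> i"
      using permutes_image[OF p] by blast
    with j \<alpha> n have "(1, i) \<in> parcs (path_graph n)" by (simp add: automorphisms_def)
    with i show ?thesis by (simp add: parcs_path_graph numeral_2_eq_2)
  qed
  have "Suc (\<alpha> 1) = \<alpha> 2" "\<alpha> 1 - 1 = \<alpha> 2"
    by (rule only; use a inner in \<open>auto simp: parcs_path_graph\<close>)+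
  then show False by simp
qed

lemma automorphisms_path_graph:
  assumes n: "n \<ge> 1"
  shows "automorphisms (path_graph n) = {id, path_reversal n}"
proof -
  have "\<alpha> = id \<or> \<alpha> = path_reversal n" if \<alpha>: "\<alpha> \<in> automorphisms (path_graph n)" for \<alpha>
    using path_automorphism_end[OF \<alpha> n]
  proof
    assume "\<alpha> 1 = 1"
    then show ?thesis using path_automorphism_fixing_end[OF \<alpha>] by simp
  next
    assume "\<alpha> 1 = n"
    then have "path_reversal n \<circ> \<alpha> = id"
      using n
      by (intro path_automorphism_fixing_end[of _ n] comp_in_automorphisms \<alpha>
            path_reversal_in_automorphisms)
         (simp add: path_reversal_def)
    then have "path_reversal n (\<alpha> i) = i" for i by (simp add: fun_eq_iff)
    then have "\<alpha> i = path_reversal n i" for i by (metis path_reversal_involution)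
    then show ?thesis by blast
  qed
  then show ?thesis
    using id_in_automorphisms path_reversal_in_automorphisms by blast
qed

lemma path_reversal_neq_id:
  assumes "n \<ge> 2"
  shows "path_reversal n \<noteq> id"
  using assms by (auto simp: fun_eq_iff path_reversal_def intro!: exI[of _ 1])

section \<open>Palindromes\<close>

definition palindromes :: "nat \<Rightarrow> nat \<Rightarrow> (nat \<Rightarrow> nat) set" where
  "palindromes k n = {c \<in> {1..n} \<rightarrow>\<^sub>E {1..k}. \<forall>i\<in>{1..n}. c (Suc n - i) = c i}"

text \<open>
  The first half, rounded up so as to include the middle vertex of an odd path, can be colored
  arbitrarily; mirroring it gives the only palindrome extending it.
\<close>
lemma card_palindromes: "card (palindromes k n) = k ^ (Suc n div 2)"
proof -
  let ?h = "Suc n div 2"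
  let ?half = "\<lambda>c. restrict c {1..?h}"
  let ?unfold = "\<lambda>c. \<lambda>i\<in>{1..n}. if i \<le> ?h then c i else c (Suc n - i)"
  have "bij_betw ?half (palindromes k n) ({1..?h} \<rightarrow>\<^sub>E {1..k})"
  proof (rule bij_betw_byWitness[where f' = ?unfold])
    show "\<forall>c\<in>palindromes k n. ?unfold (?half c) = c"
    proof
      fix c assume c: "c \<in> palindromes k n"
      then have "c \<in> extensional {1..n}" by (auto simp: palindromes_def PiE_def)
      then show "?unfold (?half c) = c"
        using c by (intro extensionalityI[of _ "{1..n}"]) (auto simp: palindromes_def)
    qed
    show "\<forall>c\<in>{1..?h} \<rightarrow>\<^sub>E {1..k}. ?half (?unfold c) = c"
    proof
      fix c assume "c \<in> {1..?h} \<rightarrow>\<^sub>E {1..k}"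
      then have "c \<in> extensional {1..?h}" by (auto simp: PiE_def)
      then show "?half (?unfold c) = c"
        by (intro extensionalityI[of _ "{1..?h}"]) auto
    qed
    show "?half ` palindromes k n \<subseteq> {1..?h} \<rightarrow>\<^sub>E {1..k}"
      by (auto simp: palindromes_def PiE_iff)
    show "?unfold ` ({1..?h} \<rightarrow>\<^sub>E {1..k}) \<subseteq> palindromes k n"
    proof
      fix d assume "d \<in> ?unfold ` ({1..?h} \<rightarrow>\<^sub>E {1..k})"
      then obtain c where c: "c \<in> {1..?h} \<rightarrow>\<^sub>E {1..k}" and d: "d = ?unfold c" by blast
      have "d i \<in> {1..k}" if "i \<in> {1..n}" for i
      proof (cases "i \<le> ?h")
        case True
        then have "d i = c i" "i \<in> {1..?h}" using that d by auto
        then show ?thesis using PiE_mem[OF c] by simp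
      next
        case False
        then have "d i = c (Suc n - i)" "Suc n - i \<in> {1..?h}" using that d by auto
        then show ?thesis using PiE_mem[OF c] by simp
      qed
      moreover have "d (Suc n - i) = d i" if "i \<in> {1..n}" for i
      proof -
        \<comment> \<open>Apart from a middle vertex, each vertex and its mirror image lie in different halves.\<close>
        have "i = Suc n - i \<or> (i \<le> ?h \<longleftrightarrow> \<not> Suc n - i \<le> ?h)"
          using that by (auto simp del: div_Suc)
        then show ?thesis using that unfolding d by auto
      qed
      moreover have "d \<in> extensional {1..n}" by (simp add: d)
      ultimately show "d \<in> palindromes k n"
        by (auto simp: palindromes_def PiE_def)
    qed
  qed
  from bij_betw_same_card[OF this] show ?thesis
    by (simp add: card_PiE)
qed

section \<open>Counting colorings of a path\<close>

lemma distinguishing_colorings_path_graph: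
  assumes n: "n \<ge> 2"
  shows "distinguishing_colorings k (path_graph n) = ({1..n} \<rightarrow>\<^sub>E {1..k}) - palindromes k n"
proof -
  have "distinguishing (path_graph n) c \<longleftrightarrow> \<not> (\<forall>i\<in>{1..n}. c (Suc n - i) = c i)"
    for c :: "nat \<Rightarrow> nat"
    using n path_reversal_neq_id[OF n]
    by (auto simp: distinguishing_def automorphisms_path_graph path_reversal_def)
  then show ?thesis
    by (auto simp: distinguishing_colorings_def palindromes_def)
qed

lemma Phi_path_graph:
  assumes n: "n \<ge> 2"
  shows "2 * Phi k (path_graph n) + k ^ (Suc n div 2) = k ^ n"
proof -
  let ?C = "{1..n} \<rightarrow>\<^sub>E {1..k}"
  have fin: "finite ?C" by (simp add: finite_PiE)
  have sub: "palindromes k n \<subseteq> ?C" by (auto simp: palindromes_def)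
  have "card (automorphisms (path_graph n)) = 2"
    using n path_reversal_neq_id[OF n] by (simp add: automorphisms_path_graph)
  then have "2 * Phi k (path_graph n) = card (?C - palindromes k n)"
    using card_distinguishing_colorings[of "path_graph n" k]
    by (simp add: distinguishing_colorings_path_graph[OF n])
  also have "\<dots> = card ?C - card (palindromes k n)"
    by (rule card_Diff_subset[OF finite_subset[OF sub fin] sub])
  finally show ?thesis
    using card_mono[OF fin sub] by (simp add: card_palindromes card_PiE)
qed

lemma two_times_choose_two: "2 * (k choose 2) + k = k ^ 2" for k :: nat
proof -
  have "even (k * (k - 1))" by (cases k) simp_all
  then have "2 * (k choose 2) = k * (k - 1)" by (simp only: choose_two dvd_mult_div_cancel)
  then show ?thesis by (cases k) (simp_all add: power2_eq_square)
qed

theorem theorem2p1: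
  fixes k :: nat
  assumes "k > 0"
  shows "(\<forall>n::nat. n \<ge> 4 \<longrightarrow>
            Phi k (path_graph n) = (k choose 2) * k ^ (n - 2) + k * Phi k (path_graph (n - 2)))
       \<and> Phi k (path_graph 2) = (k choose 2)
       \<and> Phi k (path_graph 3) = k * (k choose 2)"
proof (intro conjI allI impI)
  fix n :: nat assume "n \<ge> 4"
  define m where "m = n - 2"
  with \<open>n \<ge> 4\<close> have m: "n = m + 2" "m \<ge> 2" by simp_all
  let ?\<Phi> = "\<lambda>n. Phi k (path_graph n)"
  have "2 * ?\<Phi> n + k * k ^ (Suc m div 2) = k ^ 2 * k ^ m"
    using Phi_path_graph[of n k] m by (simp add: power2_eq_square)
  also have "\<dots> = (2 * (k choose 2) + k) * k ^ m"
    by (simp only: two_times_choose_two)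
  also have "\<dots> = 2 * (k choose 2) * k ^ m + k * (2 * ?\<Phi> m + k ^ (Suc m div 2))"
    by (simp only: Phi_path_graph[OF m(2)] distrib_right)
  finally show "?\<Phi> n = (k choose 2) * k ^ (n - 2) + k * ?\<Phi> (n - 2)"
    by (simp add: m distrib_left)
next
  show "Phi k (path_graph 2) = (k choose 2)"
    using Phi_path_graph[of 2 k] two_times_choose_two[of k] by simp
next
  have "2 * Phi k (path_graph 3) + k ^ 2 = k * (2 * (k choose 2) + k)"
    using Phi_path_graph[of 3 k]
    by (simp only: two_times_choose_two) (simp add: power2_eq_square power3_eq_cube)
  then show "Phi k (path_graph 3) = k * (k choose 2)"
    by (simp add: power2_eq_square distrib_left)
qed

end
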